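(* For every integer $n\ge 1$, $$|RAI_{2n}(2143)|=M_{n-1},$$ where $M_k$ is the $k$-th Motzkin number.
   Context: Let $S_n$ be the set of permutations $\pi=\pi_1\ldots\pi_n$ of $\{1,\ldots,n\}$. A permutation is reverse alternating if, for all $1\le i\le n-1$, $\pi_i>\pi_{i+1}$ if and only if $i$ is odd. $RAI_n$ is the set of reverse alternating involutions ($\pi=\pi^{-1}$) in $S_n$. A permutation $\pi\in S_n$ avoids the pattern $\tau\in S_k$ if there are no indices $i_1<\cdots<i_k$ such that $\pi_{i_1}\ldots\pi_{i_k}$ is order-isomorphic to $\tau$; $RAI_n(\tau)$ is the set of elements of $RAI_n$ avoiding $\tau$. The Motzkin number $M_n$ is the number of Motzkin paths of length $n$, i.e. lattice paths from $(0,0)$ to $(n,0)$ with steps $U=(1,1)$, $D=(1,-1)$, $H=(1,0)$ that stay weakly above the $x$-axis (so $M_0=M_1=1$, $M_2=2$, $M_3=4$). *)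

theory Defs
  imports
    "HOL-Combinatorics.Permutations"
    "HOL-Library.Product_Plus"
begin

text \<open>A permutation of \<open>{1..n}\<close> is a function \<open>p\<close> with \<open>p permutes {1..n}\<close>
  (hence the identity outside \<open>{1..n}\<close>); its one-line notation is \<open>p 1, \<dots>, p n\<close>.\<close>

definition reverse_alternating :: "nat \<Rightarrow> (nat \<Rightarrow> nat) \<Rightarrow> bool" where
  "reverse_alternating n p \<longleftrightarrow> (\<forall>i\<in>{1..<n}. p i > p (i + 1) \<longleftrightarrow> odd i)"

definition RAI :: "nat \<Rightarrow> (nat \<Rightarrow> nat) set" where
  "RAI n = {p. p permutes {1..n} \<and> inv p = p \<and> reverse_alternating n p}"

text \<open>The increasing map \<open>f\<close> lists the indices \<open>i\<^sub>1 < \<dots> < i\<^sub>k\<close> of an occurrence of the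
  pattern \<open>t\<close>, a permutation of \<open>{1..k}\<close>.\<close>

definition avoids :: "nat \<Rightarrow> (nat \<Rightarrow> nat) \<Rightarrow> nat \<Rightarrow> (nat \<Rightarrow> nat) \<Rightarrow> bool" where
  "avoids n p k t \<longleftrightarrow>
     \<not> (\<exists>f. strict_mono_on {1..k} f \<and> f ` {1..k} \<subseteq> {1..n} \<and>
          (\<forall>a\<in>{1..k}. \<forall>b\<in>{1..k}. p (f a) < p (f b) \<longleftrightarrow> t a < t b))"

definition RAI_avoiding :: "nat \<Rightarrow> nat \<Rightarrow> (nat \<Rightarrow> nat) \<Rightarrow> (nat \<Rightarrow> nat) set" where
  "RAI_avoiding n k t = {p \<in> RAI n. avoids n p k t}"

definition one_line :: "nat list \<Rightarrow> nat \<Rightarrow> nat" where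
  "one_line xs i = (if i \<in> {1..length xs} then xs ! (i - 1) else i)"

text \<open>A lattice path starting at \<open>(0, 0)\<close> is given by its list of steps, so the vertices
  of the path are the sums of the initial segments of the list.\<close>

definition motzkin_paths :: "nat \<Rightarrow> (int \<times> int) list set" where
  "motzkin_paths n = {w. set w \<subseteq> {(1, 1), (1, - 1), (1, 0)} \<and> sum_list w = (int n, 0) \<and>
     (\<forall>i\<le>length w. 0 \<le> snd (sum_list (take i w)))}"

definition motzkin :: "nat \<Rightarrow> nat" where
  "motzkin n = card (motzkin_paths n)"

lemma one_line_2143_permutes: "one_line [2, 1, 4, 3] permutes {1..4}"
proof (rule bij_imp_permutes)
  have dom: "{1..4::nat} = {1, 2, 3, 4}" by auto
  show "bij_betw (one_line [2, 1, 4, 3]) {1..4} {1..4}"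
    unfolding dom by (auto simp: bij_betw_def inj_on_def one_line_def)
qed (auto simp: one_line_def)

lemma finite_RAI: "finite (RAI n)"
  by (rule finite_subset[OF _ finite_permutations[of "{1..n}"]]) (auto simp: RAI_def)

lemma motzkin_path_length:
  assumes "w \<in> motzkin_paths n"
  shows "length w = n"
proof -
  have "fst (sum_list w) = int (length w)" if "set w \<subseteq> {(1, 1), (1, - 1), (1, 0::int)}"
    for w :: "(int \<times> int) list"
    using that by (induction w) auto
  from this[of w] show ?thesis using assms by (simp add: motzkin_paths_def)
qed

lemma finite_motzkin_paths: "finite (motzkin_paths n)"
proof (rule finite_subset)
  show "motzkin_paths n \<subseteq> {w. set w \<subseteq> {(1, 1), (1, - 1), (1, 0)} \<and> length w = n}"
    using motzkin_path_length by (auto simp: motzkin_paths_def)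
qed (rule finite_lists_length_eq, simp)

end

theory Submission
  imports Defs
begin

text \<open>Let \<open>V\<^sub>c(s, t)\<close> be the number of 2143-avoiding involutions with the step word
  \<open>u\<dots>u d u d \<dots> u d u\<dots>u\<close> that has \<open>c\<close> descents, \<open>s\<close> ascents before the first and \<open>t\<close> ascents after the
  last of them. Because 2143 is its own inverse, such an involution \<open>p\<close> increases from position \<open>p d\<close>
  on, where \<open>d = s + 1\<close> is the position of the first peak. Hence \<open>p d\<close> lies in the final ascending
  run. If it is not the first position of that run, deleting the cycle of \<open>d\<close> and \<open>p d\<close> shortens both
  outer runs by one; otherwise the two steps at the seams become free, except that two descents
  there are impossible. The resulting recursion for \<open>V\<close> is also satisfied by the number of paths with
  steps \<open>U, D, H\<close> of length \<open>c - 1\<close> that stay weakly above the axis, start at height at most \<open>s\<close> and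
  end at height at most \<open>t\<close>. Reverse alternating means \<open>s = t = 0\<close> and \<open>c = n\<close>.\<close>

section \<open>Involutions, pattern avoidance and descents as pointwise conditions\<close>

definition involution_upto :: "nat \<Rightarrow> (nat \<Rightarrow> nat) \<Rightarrow> bool" where
  "involution_upto n p \<longleftrightarrow> (\<forall>x. p (p x) = x) \<and> (\<forall>x. x \<notin> {1..n} \<longrightarrow> p x = x)"

definition avoids_2143 :: "(nat \<Rightarrow> nat) \<Rightarrow> bool" where
  "avoids_2143 p \<longleftrightarrow>
     (\<forall>i j k l. i < j \<and> j < k \<and> k < l \<longrightarrow> \<not> (p j < p i \<and> p i < p l \<and> p l < p k))"

text \<open>The index needs no bound: an involution with \<open>involution_upto n p\<close> fixes 0
  and everything above \<open>n\<close>, so there is no descent at 0 or from \<open>n\<close>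
  on.\<close>

definition descents :: "(nat \<Rightarrow> nat) \<Rightarrow> nat set" where
  "descents p = {i. p (Suc i) < p i}"

lemma involution_upto_inj: "involution_upto n p \<Longrightarrow> p x = p y \<longleftrightarrow> x = y"
  unfolding involution_upto_def by metis

lemma involution_upto_le: "involution_upto n p \<Longrightarrow> p x \<le> n \<longleftrightarrow> x \<le> n"
  unfolding involution_upto_def
  by (metis atLeastAtMost_iff linorder_not_le order.trans)

lemma involution_upto_0: "involution_upto n p \<Longrightarrow> p 0 = 0"
  unfolding involution_upto_def by simp

lemma involution_upto_gt_0: "involution_upto n p \<Longrightarrow> 0 < p x \<longleftrightarrow> 0 < x"
  using involution_upto_0 involution_upto_inj by (metis gr0I less_irrefl)

lemma finite_involution_upto: "finite {p. involution_upto n p}"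
proof (rule finite_subset)
  show "{p. involution_upto n p} \<subseteq> {p. p permutes {1..n}}"
  proof clarify
    fix p assume p: "involution_upto n p"
    have "p \<circ> p = id"
      using p by (auto simp: involution_upto_def)
    then have "bij p"
      using o_bij by blast
    with p show "p permutes {1..n}"
      by (simp add: permutes_def involution_upto_def bij_iff)
  qed
qed (simp add: finite_permutations)

lemma less_descentD:
  assumes "involution_upto n p" "i \<notin> descents p"
  shows "p i < p (Suc i)"
  using assms involution_upto_inj[OF assms(1), of i "Suc i"]
  by (auto simp: descents_def)

lemma increasing_between_descents:
  assumes "involution_upto n p" "\<And>i. l \<le> i \<Longrightarrow> i < u \<Longrightarrow> i \<notin> descents p"
    and "l \<le> x" "x < y" "y \<le> u"
  shows "p x < p y"
  using assms(4,5)
proof (induction y)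
  case (Suc y)
  have "p y < p (Suc y)"
    using less_descentD[OF assms(1), of y] assms(2,3) Suc.prems by auto
  with Suc show ?case
    by (cases "x = y") auto
qed simp

text \<open>If \<open>x < p x\<close>, then monotonicity gives \<open>p x < p (p x) = x\<close>; the
  case \<open>p x < x\<close> is symmetric.\<close>

lemma no_descents_imp_id:
  assumes "involution_upto n p" "descents p = {}"
  shows "p = id"
proof
  fix x
  have incr: "p i < p j" if "i < j" for i j
    using increasing_between_descents[OF assms(1), of i j i j] assms(2) that by auto
  have "p (p x) = x"
    using assms(1) by (simp add: involution_upto_def)
  with incr[of x "p x"] incr[of "p x" x] show "p x = id x"
    by (cases "p x" x rule: linorder_cases) auto
qed

section \<open>Deleting and inserting a 2-cycle\<close>

text \<open>\<open>spread a b\<close> enumerates the complement of \<open>{a, b}\<close> increasingly, \<open>squash a b\<close> is its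
  inverse; they renumber positions and values when the cycle \<open>(a b)\<close> is inserted or deleted.\<close>

definition spread :: "nat \<Rightarrow> nat \<Rightarrow> nat \<Rightarrow> nat" where
  "spread a b x = (if x < a then x else if Suc x < b then Suc x else x + 2)"

definition squash :: "nat \<Rightarrow> nat \<Rightarrow> nat \<Rightarrow> nat" where
  "squash a b x = (if x < a then x else if x < b then x - 1 else x - 2)"

definition insert_cycle :: "nat \<Rightarrow> nat \<Rightarrow> (nat \<Rightarrow> nat) \<Rightarrow> nat \<Rightarrow> nat" where
  "insert_cycle a b q x =
     (if x = a then b else if x = b then a else spread a b (q (squash a b x)))"

definition delete_cycle :: "nat \<Rightarrow> nat \<Rightarrow> (nat \<Rightarrow> nat) \<Rightarrow> nat \<Rightarrow> nat" where
  "delete_cycle a b p x = squash a b (p (spread a b x))"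

lemma squash_spread: "a < b \<Longrightarrow> squash a b (spread a b x) = x"
  by (auto simp: squash_def spread_def)

lemma spread_squash: "a < b \<Longrightarrow> x \<noteq> a \<Longrightarrow> x \<noteq> b \<Longrightarrow> spread a b (squash a b x) = x"
  by (auto simp: squash_def spread_def)

lemma spread_neq: "a < b \<Longrightarrow> spread a b x \<noteq> a \<and> spread a b x \<noteq> b"
  by (auto simp: spread_def)

lemma spread_less_iff: "a < b \<Longrightarrow> spread a b x < spread a b y \<longleftrightarrow> x < y"
  by (auto simp: spread_def)

lemma squash_less_iff:
  assumes "a < b" "x \<notin> {a, b}" "y \<notin> {a, b}"
  shows "squash a b x < squash a b y \<longleftrightarrow> x < y"
  using spread_less_iff[OF assms(1), of "squash a b x" "squash a b y"] assms
  by (simp add: spread_squash)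

lemma insert_cycle_endpoints: "insert_cycle a b q a = b" "a < b \<Longrightarrow> insert_cycle a b q b = a"
  by (simp_all add: insert_cycle_def)

lemma delete_insert_cycle: "a < b \<Longrightarrow> delete_cycle a b (insert_cycle a b q) = q"
  by (rule ext) (simp add: delete_cycle_def insert_cycle_def spread_neq squash_spread)

lemma insert_cycle_spread: "a < b \<Longrightarrow> insert_cycle a b q (spread a b x) = spread a b (q x)"
  by (simp add: insert_cycle_def spread_neq squash_spread)

lemma involution_insert_cycle:
  assumes "involution_upto n q" "1 \<le> a" "a < b" "b \<le> n + 2"
  shows "involution_upto (n + 2) (insert_cycle a b q)"
  unfolding involution_upto_def
proof (intro conjI allI impI)
  fix x
  show "insert_cycle a b q (insert_cycle a b q x) = x"
  proof (cases "x = a \<or> x = b")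
    case False
    then obtain y where "x = spread a b y"
      using spread_squash[OF assms(3)] by metis
    with assms show ?thesis
      by (simp add: insert_cycle_spread involution_upto_def)
  qed (use assms in \<open>auto simp: insert_cycle_def\<close>)
next
  fix x assume x: "x \<notin> {1..n + 2}"
  then have "squash a b x \<notin> {1..n}"
    using assms by (auto simp: squash_def)
  then have "q (squash a b x) = squash a b x"
    using assms unfolding involution_upto_def by blast
  with x assms show "insert_cycle a b q x = x"
    by (auto simp: insert_cycle_def spread_squash)
qed

context
  fixes n a b :: nat and p :: "nat \<Rightarrow> nat"
  assumes p: "involution_upto (n + 2) p" and ab: "p a = b" "a < b"
begin

lemma involution_pba: "p b = a"
  using p ab unfolding involution_upto_def by auto

lemma image_spread_neq: "p (spread a b x) \<notin> {a, b}"
  using involution_upto_inj[OF p] ab involution_pba spread_neq[OF ab(2), of x]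
  by (metis insert_iff singletonD)

lemma delete_cycle_less_iff:
  "delete_cycle a b p x < delete_cycle a b p y \<longleftrightarrow> p (spread a b x) < p (spread a b y)"
  unfolding delete_cycle_def using squash_less_iff[OF ab(2)] image_spread_neq by blast

lemma insert_delete_cycle: "insert_cycle a b (delete_cycle a b p) = p"
proof
  fix x
  show "insert_cycle a b (delete_cycle a b p) x = p x"
  proof (cases "x = a \<or> x = b")
    case False
    then show ?thesis
      using image_spread_neq[of "squash a b x"] ab
      by (simp add: insert_cycle_def delete_cycle_def spread_squash)
  qed (use ab involution_pba in \<open>auto simp: insert_cycle_def\<close>)
qed

lemma cycle_bounds: "1 \<le> a" "b \<le> n + 2"
  using involution_upto_le[OF p, of a] involution_upto_gt_0[OF p, of a] ab
    involution_upto_le[OF p, of b] involution_pba p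
  unfolding involution_upto_def by auto

lemma involution_delete_cycle: "involution_upto n (delete_cycle a b p)"
  unfolding involution_upto_def
proof (intro conjI allI impI)
  fix x
  have "p (spread a b x) \<noteq> a" "p (spread a b x) \<noteq> b"
    using image_spread_neq[of x] by auto
  then show "delete_cycle a b p (delete_cycle a b p x) = x"
    using p ab(2) by (simp add: delete_cycle_def spread_squash squash_spread involution_upto_def)
next
  fix x assume "x \<notin> {1..n}"
  then have "spread a b x \<notin> {1..n + 2}"
    using cycle_bounds ab(2) by (auto simp: spread_def)
  then show "delete_cycle a b p x = x"
    using p ab(2) by (auto simp: delete_cycle_def squash_spread involution_upto_def)
qed

lemma avoids_delete_cycle: "avoids_2143 p \<Longrightarrow> avoids_2143 (delete_cycle a b p)"
  unfolding avoids_2143_def delete_cycle_less_iff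
  using spread_less_iff[OF ab(2)] by blast

text \<open>An occurrence of 2143 that uses the position \<open>a\<close> must use it as the \<open>2\<close>; the position \<open>b\<close>
  is reduced to this case because 2143 is its own inverse.\<close>

lemma avoids_insert_cycle:
  assumes avoid: "avoids_2143 (delete_cycle a b p)"
    and below: "\<And>x y. x < y \<Longrightarrow> y \<le> a \<Longrightarrow> p x < p y"
    and above: "\<And>x y. b < x \<Longrightarrow> x < y \<Longrightarrow> p x < p y"
  shows "avoids_2143 p"
  unfolding avoids_2143_def
proof (intro allI impI notI; elim conjE)
  have a: False
    if ord: "i < j" "j < k" "k < l" "p j < p i" "p i < p l" "p l < p k" and "a \<in> {i, j, k, l}"
    for i j k l
  proof -
    \<comment> \<open>\<open>p\<close> increases up to \<open>a\<close>, so the inversion at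
      \<open>i\<close>, \<open>j\<close> forces \<open>a < j\<close>.\<close>
    have "i = a"
      using that below[of i j] by auto
    \<comment> \<open>Both \<open>p l\<close> and \<open>p k\<close> exceed \<open>p i = b\<close>,
      where \<open>p\<close> increases; this would give \<open>l < k\<close>.\<close>
    then have "p (p l) < p (p k)"
      using ord above[of "p l" "p k"] ab by auto
    with ord show False
      using p by (simp add: involution_upto_def)
  qed
  fix i j k l
  assume ord: "i < j" "j < k" "k < l" "p j < p i" "p i < p l" "p l < p k"
  have pp: "p (p x) = x" for x
    using p by (simp add: involution_upto_def)
  have "a \<notin> {i, j, k, l}"
    using a[OF ord] by blast
  moreover have "b \<notin> {i, j, k, l}"
  proof
    assume "b \<in> {i, j, k, l}"
    then have "a \<in> {p j, p i, p l, p k}"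
      using involution_pba by auto
    \<comment> \<open>The inverse occurrence: positions \<open>p j < p i < p l < p k\<close> carry
      the values \<open>j, i, l, k\<close>, again a 2143.\<close>
    then show False
      using a[of "p j" "p i" "p l" "p k"] ord by (simp add: pp)
  qed
  ultimately obtain i' j' k' l' where
    "i = spread a b i'" "j = spread a b j'" "k = spread a b k'" "l = spread a b l'"
    using spread_squash[OF ab(2)] by (metis insertCI)
  with ord avoid show False
    unfolding avoids_2143_def delete_cycle_less_iff
    using spread_less_iff[OF ab(2)] by blast
qed

lemma descents_delete_cycle:
  "i \<in> descents (delete_cycle a b p) \<longleftrightarrow> p (spread a b (Suc i)) < p (spread a b i)"
  by (simp add: descents_def delete_cycle_less_iff)

end

section \<open>Structure around the first peak \<open>d\<close>\<close>

definition every_other :: "nat \<Rightarrow> nat \<Rightarrow> nat set" where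
  "every_other d c = {i. d \<le> i \<and> i < d + 2 * c \<and> (even i \<longleftrightarrow> even d)}"

lemma every_other_ge: "i \<in> every_other d c \<Longrightarrow> d \<le> i"
  by (simp add: every_other_def)

text \<open>The step word of an element of \<open>vex n d c\<close>, \<open>c > 0\<close>, is \<open>u\<^sup>s (d u)\<^sup>c\<^sup>-\<^sup>1 d u\<^sup>t\<close> with \<open>s = d - 1\<close> and
  \<open>n = s + t + 2 c\<close>. There are no elements for \<open>d = 0 < c\<close> or \<open>n < d - 1 + 2 c\<close>, so that truncated
  subtractions in the arguments are harmless below.\<close>

definition vex :: "nat \<Rightarrow> nat \<Rightarrow> nat \<Rightarrow> (nat \<Rightarrow> nat) set" where
  "vex n d c = {p. involution_upto n p \<and> avoids_2143 p \<and> descents p = every_other d c}"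

lemma finite_vex: "finite (vex n d c)"
  by (rule finite_subset[OF _ finite_involution_upto[of n]]) (auto simp: vex_def)

lemma vex_0: "vex n d 0 = {id}"
proof -
  have "descents id = {}" "every_other d 0 = {}"
    by (auto simp: descents_def every_other_def)
  then show ?thesis
    using no_descents_imp_id
    by (auto simp: vex_def involution_upto_def avoids_2143_def)
qed

context
  fixes n d c :: nat and p :: "nat \<Rightarrow> nat"
  assumes vex: "p \<in> vex n d c" and c: "1 \<le> c"
begin

lemma vex_involution: "involution_upto n p" "p (p x) = x"
  using vex by (auto simp: vex_def involution_upto_def)

lemma vex_descent_iff: "p (Suc i) < p i \<longleftrightarrow> d \<le> i \<and> i < d + 2 * c \<and> (even i \<longleftrightarrow> even d)"
  using vex by (auto simp: vex_def descents_def every_other_def)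

lemma vex_ascent: "\<not> (d \<le> i \<and> i < d + 2 * c \<and> (even i \<longleftrightarrow> even d)) \<Longrightarrow> p i < p (Suc i)"
  using vex_descent_iff less_descentD[OF vex_involution(1)] by (simp add: descents_def)

lemma vex_first_pos: "1 \<le> d"
  using vex_descent_iff[of 0] c involution_upto_0[OF vex_involution(1)] by (cases d) auto

lemma vex_prefix: "x < y \<Longrightarrow> y \<le> d \<Longrightarrow> p x < p y"
  using increasing_between_descents[OF vex_involution(1), of 0 d x y] vex_descent_iff
  by (auto simp: descents_def)

lemma vex_first_descent: "p (Suc d) < p d"
  using vex_descent_iff[of d] c by simp

text \<open>The increasing prefix gives \<open>x \<le> p x\<close> for \<open>x \<le> d\<close>. If
  \<open>d\<close> were fixed, the smaller value \<open>v = p (d + 1)\<close> would satisfy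
  \<open>p v < d\<close>, although \<open>p v = d + 1\<close>.\<close>

lemma vex_peak_gt: "d < p d"
proof -
  have ge: "x \<le> p x" if "x \<le> d" for x
    using that
  proof (induction x)
    case (Suc x)
    with vex_prefix[of x "Suc x"] show ?case by auto
  qed simp
  moreover have "p d \<noteq> d"
  proof
    assume eq: "p d = d"
    then have lt: "p (Suc d) < d"
      using vex_first_descent by simp
    then have "p (Suc d) \<le> p (p (Suc d))" "p (p (Suc d)) < p d"
      using ge[of "p (Suc d)"] vex_prefix[of "p (Suc d)" d] by auto
    with eq vex_involution(2) show False by simp
  qed
  ultimately show ?thesis
    using le_neq_implies_less by (metis order_refl)
qed

text \<open>A descent beyond position \<open>p d\<close> would form a 2143 with the values \<open>d + 1\<close> and \<open>d\<close>.\<close>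

lemma vex_suffix:
  assumes "p d \<le> x" "x < y"
  shows "p x < p y"
proof -
  \<comment> \<open>\<open>p d\<close> is the largest of \<open>p 0, ..., p (d + 1)\<close>, so
    values up to \<open>d + 1\<close> occur only at positions up to \<open>p d\<close>.\<close>
  have beyond: "Suc d < p z" if "p d < z" for z
  proof (rule ccontr)
    assume "\<not> Suc d < p z"
    then have "p z = Suc d \<or> p z \<le> d" by linarith
    then have "p (p z) \<le> p d"
      using vex_first_descent vex_prefix[of "p z" d] by (cases "p z = d") auto
    with that vex_involution(2) show False by simp
  qed
  show ?thesis
  proof (cases "x = p d")
    case True
    with assms beyond[of y] vex_involution(2)[of d] show ?thesis by simp
  next
    case False
    with assms have x: "p d < x" by simp
    have "\<not> p y < p x"
    proof
      assume "p y < p x"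
      with beyond[of y] x assms(2) vex vex_first_descent show False
        unfolding vex_def avoids_2143_def
        by (auto dest!: spec[of _ "p (Suc d)"] spec[of _ "p d"] spec[of _ x] spec[of _ y]
            simp: vex_involution(2))
    qed
    with assms(2) involution_upto_inj[OF vex_involution(1), of x y] show ?thesis by simp
  qed
qed

text \<open>The last descent, at \<open>d + 2 * c - 2\<close>, must come before position
  \<open>p d\<close>, from which \<open>p\<close> increases.\<close>

lemma vex_peak_ge: "d + 2 * c \<le> Suc (p d)"
proof (rule ccontr)
  assume "\<not> d + 2 * c \<le> Suc (p d)"
  then have "p d \<le> d + 2 * c - 2" by simp
  moreover have "p (Suc (d + 2 * c - 2)) < p (d + 2 * c - 2)"
    unfolding vex_descent_iff using c by auto
  ultimately show False
    using vex_suffix[of "d + 2 * c - 2" "Suc (d + 2 * c - 2)"] by simp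
qed

lemma vex_size: "d + 2 * c \<le> n + 1" "p d \<le> n"
proof -
  have "d \<le> n"
  proof (rule ccontr)
    assume "\<not> d \<le> n"
    then have "p d = d"
      using vex_involution(1) by (simp add: involution_upto_def)
    with vex_peak_gt show False by simp
  qed
  then show "p d \<le> n"
    using involution_upto_le[OF vex_involution(1), of d] by simp
  with vex_peak_ge show "d + 2 * c \<le> n + 1" by simp
qed

text \<open>Here \<open>p d\<close> is not the first position of the last run, so
  \<open>p (p d - 1) < d\<close>. A value below \<open>d - 1\<close> is excluded because
  \<open>p (d - 1)\<close> would then lie strictly between \<open>p d - 1\<close> and
  \<open>p d\<close>. As 0 is fixed, \<open>d = 1\<close> is impossible.\<close>

lemma vex_band:
  assumes "d + 2 * c \<le> p d"
  shows "p (d - 1) = p d - 1" "2 \<le> d"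
proof -
  obtain y where y: "p d = Suc y"
    using vex_peak_gt by (cases "p d") auto
  have "d + 2 * c \<le> Suc y"
    using assms y by simp
  then have "p y < p (Suc y)"
    by (intro vex_ascent) presburger
  then have less: "p y < d"
    using y vex_involution(2)[of d] by simp
  then have "\<not> p y < d - 1"
    using vex_prefix[of "p y" "d - 1"] vex_prefix[of "d - 1" d] y vex_involution(2)[of y] by auto
  with less have "p y = d - 1" by simp
  with y vex_involution(2)[of y] show "p (d - 1) = p d - 1" by simp
  then show "2 \<le> d"
    using vex_peak_gt vex_first_pos involution_upto_0[OF vex_involution(1)]
    by (cases "d = 1") auto
qed

end

lemma vex_first_pos_0: "1 \<le> c \<Longrightarrow> vex n 0 c = {}"
  using vex_first_pos by fastforce

section \<open>First peaks above their least possible value\<close>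

lemma insert_cycle_eqs:
  assumes "a < b"
  shows "x < a \<Longrightarrow> insert_cycle a b q x = spread a b (q x)"
    and "a < x \<Longrightarrow> x < b \<Longrightarrow> insert_cycle a b q x = spread a b (q (x - 1))"
    and "b < x \<Longrightarrow> insert_cycle a b q x = spread a b (q (x - 2))"
  using assms by (auto simp: insert_cycle_def squash_def)

text \<open>\<open>k\<close> bounds from below the excess of \<open>p d\<close> over its least value
  \<open>d + 2 * c - 1\<close>.\<close>

definition vex_peak_at_least :: "nat \<Rightarrow> nat \<Rightarrow> nat \<Rightarrow> nat \<Rightarrow> (nat \<Rightarrow> nat) set" where
  "vex_peak_at_least n d c k = {p \<in> vex n d c. d + 2 * c + k \<le> Suc (p d)}"

lemma finite_vex_peak_at_least: "finite (vex_peak_at_least n d c k)"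
  unfolding vex_peak_at_least_def using finite_vex by simp

lemma vex_peak_at_least_0: "1 \<le> c \<Longrightarrow> vex_peak_at_least n d c 0 = vex n d c"
  unfolding vex_peak_at_least_def using vex_peak_ge by auto

lemma delete_cycle_vex_peak_at_least:
  assumes p: "p \<in> vex_peak_at_least n d c (Suc k)" and c: "1 \<le> c"
  shows "delete_cycle d (p d) p \<in> vex_peak_at_least (n - 2) (d - 1) c k"
    and "insert_cycle d (delete_cycle d (p d) p (d - 1) + 2) (delete_cycle d (p d) p) = p"
proof -
  have vex: "p \<in> vex n d c" and peak: "d + 2 * c + k \<le> p d"
    using p by (auto simp: vex_peak_at_least_def)
  note band = vex_band[OF vex c]
  have d: "2 \<le> d" and pd1: "p (d - 1) = p d - 1"
    using band peak by auto
  obtain b where b: "p d = b" by simp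
  have db: "d + 2 * c \<le> b" "d < b"
    using peak c b by auto
  obtain m where n: "n = m + 2"
    using vex_size(2)[OF vex c] db d b by (metis add.commute le_Suc_ex order_trans less_imp_le)
  have inv: "involution_upto (m + 2) p"
    using vex_involution(1)[OF vex c] n by simp
  note pp = vex_involution(2)[OF vex c]
  define q where "q = delete_cycle d b p"
  have ins: "insert_cycle d b q = p"
    unfolding q_def by (rule insert_delete_cycle[OF inv b db(2)])
  \<comment> \<open>The value \<open>b - 1\<close> at \<open>d - 1\<close> drops by one, so the
    deleted position \<open>b\<close> can be read off from \<open>q\<close>.\<close>
  have "q (d - 1) = b - 2"
    unfolding q_def delete_cycle_def using d pd1 b db c by (simp add: spread_def squash_def) arith
  then have "q (d - 1) + 2 = b"
    using db c by simp
  with ins show "insert_cycle d (delete_cycle d (p d) p (d - 1) + 2) (delete_cycle d (p d) p) = p"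
    unfolding q_def b by simp
  \<comment> \<open>Since \<open>p (d - 1)\<close> is just below \<open>p d\<close>, it also exceeds
    \<open>p (d + 1)\<close>: the left seam becomes the new first descent.\<close>
  have pSd: "p (Suc d) < p (d - 1)"
    using vex_first_descent[OF vex c] pd1 involution_upto_inj[OF inv, of "Suc d" "d - 1"] by linarith
  have "i \<in> descents q \<longleftrightarrow> i \<in> every_other (d - 1) c" for i
  proof -
    have q: "i \<in> descents q \<longleftrightarrow> p (spread d b (Suc i)) < p (spread d b i)"
      unfolding q_def by (rule descents_delete_cycle[OF inv b db(2)])
    consider "Suc i < d" | "Suc i = d" | "d \<le> i" "i + 2 < b" | "i + 2 = b" "d \<le> i" | "b \<le> Suc i"
      using db by linarith
    then show ?thesis
    proof cases
      case 1
      then show ?thesis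
        using q vex_descent_iff[OF vex c, of i] by (auto simp: spread_def every_other_def)
    next
      case 2
      then have "i = d - 1" by simp
      then show ?thesis
        using q pSd d c db by (auto simp: spread_def every_other_def)
    next
      case 3
      then have "i \<in> descents q \<longleftrightarrow> p (Suc (Suc i)) < p (Suc i)"
        using q by (simp add: spread_def)
      also have "\<dots> \<longleftrightarrow> i \<in> every_other (d - 1) c"
        unfolding vex_descent_iff[OF vex c] every_other_def mem_Collect_eq using d by presburger
      finally show ?thesis .
    next
      case 4
      then have "i \<in> descents q \<longleftrightarrow> p (Suc b) < p (b - 1)"
        using q by (auto simp: spread_def)
      \<comment> \<open>At the right seam \<open>p (b - 1) < p b < p (b + 1)\<close>, so deleting
        \<open>b\<close> leaves an ascent.\<close>
      moreover have "p (b - 1) = d - 1" "p b = d"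
        using pp[of "d - 1"] pp[of d] pd1 b by auto
      moreover have "p b < p (Suc b)"
        using vex_suffix[OF vex c, of b "Suc b"] b by simp
      moreover have "i \<notin> every_other (d - 1) c"
        unfolding every_other_def mem_Collect_eq using 4 db d by presburger
      ultimately show ?thesis by simp
    next
      case 5
      then have "i \<notin> descents q"
        using q vex_suffix[OF vex c, of "i + 2" "Suc i + 2"] b db by (auto simp: spread_def)
      moreover have "i \<notin> every_other (d - 1) c"
        using 5 db d by (auto simp: every_other_def)
      ultimately show ?thesis by simp
    qed
  qed
  then have "descents q = every_other (d - 1) c" by blast
  then have "q \<in> vex m (d - 1) c"
    using involution_delete_cycle[OF inv b db(2)] avoids_delete_cycle[OF inv b db(2)] vex
    by (simp add: vex_def q_def)
  then show "delete_cycle d (p d) p \<in> vex_peak_at_least (n - 2) (d - 1) c k"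
    using \<open>q (d - 1) = b - 2\<close> peak b n d c by (simp add: vex_peak_at_least_def q_def)
qed

lemma insert_cycle_vex_peak_at_least:
  assumes q: "q \<in> vex_peak_at_least (n - 2) (d - 1) c k" and c: "1 \<le> c"
  shows "insert_cycle d (q (d - 1) + 2) q \<in> vex_peak_at_least n d c (Suc k)"
proof -
  have vex: "q \<in> vex (n - 2) (d - 1) c" and peak: "d - 1 + 2 * c + k \<le> Suc (q (d - 1))"
    using q by (auto simp: vex_peak_at_least_def)
  have d: "2 \<le> d"
    using vex_first_pos[OF vex c] by simp
  define b where "b = q (d - 1) + 2"
  have db: "d < b" "d + 1 < b" "d + 2 * c + k \<le> b"
    using vex_peak_gt[OF vex c] d peak by (auto simp: b_def)
  have bn: "b \<le> n - 2 + 2" "2 \<le> n"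
    using vex_size(2)[OF vex c] vex_peak_gt[OF vex c] by (auto simp: b_def)
  define p where "p = insert_cycle d b q"
  note qq = vex_involution(2)[OF vex c]
  have inv: "involution_upto (n - 2 + 2) p"
    unfolding p_def using involution_insert_cycle[OF vex_involution(1)[OF vex c] _ db(1) bn(1)] d
    by simp
  have pd: "p d = b" and pb: "p b = d"
    unfolding p_def using insert_cycle_endpoints db by auto
  have del: "delete_cycle d b p = q"
    unfolding p_def by (rule delete_insert_cycle[OF db(1)])
  note eqs = insert_cycle_eqs[OF db(1), of _ q, folded p_def]
  \<comment> \<open>The choice of \<open>b\<close> places the old peak value right below the new
    one.\<close>
  have spread_peak: "spread d b (q (d - 1)) = b - 1"
    using db by (simp add: spread_def b_def)
  have below: "p x < p y" if "x < y" "y \<le> d" for x y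
  proof (cases "y = d")
    case True
    have "x = d - 1 \<or> x < d - 1"
      using that True by linarith
    then have "q x \<le> q (d - 1)"
      using vex_prefix[OF vex c, of x "d - 1"] by auto
    then have "spread d b (q x) \<le> b - 1"
      using spread_less_iff[OF db(1), of "q x" "q (d - 1)"] spread_peak
      by (cases "q x = q (d - 1)") auto
    with that True eqs(1)[of x] pd db show ?thesis by simp
  next
    case False
    with that show ?thesis
      using vex_prefix[OF vex c, of x y] eqs(1) spread_less_iff[OF db(1)] by simp
  qed
  have above: "p x < p y" if "b < x" "x < y" for x y
    using vex_suffix[OF vex c, of "x - 2" "y - 2"] that eqs(3) spread_less_iff[OF db(1)]
    by (simp add: b_def)
  have avoid: "avoids_2143 p"
    using avoids_insert_cycle[OF inv pd db(1)] below above del vex by (auto simp: vex_def)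
  have "p (Suc i) < p i \<longleftrightarrow> i \<in> every_other d c" for i
  proof -
    consider "i < d" | "i = d" | "d < i" "Suc i < b" | "Suc i = b" "d < i" | "i = b" | "b < i"
      using db by linarith
    then show ?thesis
    proof cases
      case 1
      then show ?thesis
        using below[of i "Suc i"] by (auto simp: every_other_def)
    next
      case 2
      have "q d < q (d - 1)"
        using vex_first_descent[OF vex c] d by simp
      then have "spread d b (q d) < b - 1"
        using spread_less_iff[OF db(1), of "q d" "q (d - 1)"] spread_peak by simp
      then show ?thesis
        using 2 eqs(2)[of "Suc d"] db pd c by (simp add: every_other_def)
    next
      case 3
      have i: "Suc (i - 1) = i" using 3 by simp
      have "p (Suc i) < p i \<longleftrightarrow> q (Suc (i - 1)) < q (i - 1)"
        using 3 eqs(2)[of i] eqs(2)[of "Suc i"] spread_less_iff[OF db(1)] by (simp add: i)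
      also have "\<dots> \<longleftrightarrow> i \<in> every_other d c"
        unfolding vex_descent_iff[OF vex c] every_other_def mem_Collect_eq
        using 3 d by (cases i; cases d) auto
      finally show ?thesis .
    next
      case 4
      then have "q (i - 1) = d - 1"
        using qq[of "d - 1"] by (simp add: b_def)
      then have "p i = d - 1"
        using eqs(2)[of i] 4 d by (simp add: spread_def)
      moreover have "i \<notin> every_other d c"
        unfolding every_other_def mem_Collect_eq using 4 db by presburger
      ultimately show ?thesis
        using 4 pb by simp
    next
      case 5
      have "d - 1 < q (Suc (b - 2))"
        using vex_suffix[OF vex c, of "b - 2" "Suc (b - 2)"] qq[of "d - 1"] by (simp add: b_def)
      moreover have "p (Suc b) = spread d b (q (Suc (b - 2)))"
        using eqs(3)[of "Suc b"] by (simp add: b_def)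
      ultimately have "d < p (Suc b)"
        by (auto simp: spread_def)
      with 5 pb db show ?thesis
        by (simp add: every_other_def)
    next
      case 6
      with above[of i "Suc i"] db show ?thesis
        by (simp add: every_other_def)
    qed
  qed
  then have "descents p = every_other d c"
    by (auto simp: descents_def)
  moreover have "n - 2 + 2 = n"
    using bn by simp
  ultimately have "p \<in> vex n d c"
    using avoid inv by (simp add: vex_def)
  with pd db show ?thesis
    by (simp add: vex_peak_at_least_def p_def b_def)
qed

lemma card_vex_peak_at_least_Suc:
  assumes "1 \<le> c"
  shows "card (vex_peak_at_least n d c (Suc k)) = card (vex_peak_at_least (n - 2) (d - 1) c k)"
proof (rule bij_betw_same_card, rule bij_betw_byWitness[
      where f = "\<lambda>p. delete_cycle d (p d) p" and f' = "\<lambda>q. insert_cycle d (q (d - 1) + 2) q"])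
  show "\<forall>q\<in>vex_peak_at_least (n - 2) (d - 1) c k.
      delete_cycle d (insert_cycle d (q (d - 1) + 2) q d) (insert_cycle d (q (d - 1) + 2) q) = q"
  proof
    fix q assume "q \<in> vex_peak_at_least (n - 2) (d - 1) c k"
    then have "d - 1 < q (d - 1)"
      using vex_peak_gt assms by (auto simp: vex_peak_at_least_def)
    then show "delete_cycle d (insert_cycle d (q (d - 1) + 2) q d)
        (insert_cycle d (q (d - 1) + 2) q) = q"
      by (simp add: insert_cycle_endpoints delete_insert_cycle)
  qed
qed (use delete_cycle_vex_peak_at_least insert_cycle_vex_peak_at_least assms in auto)

lemma card_vex_peak_at_least:
  "1 \<le> c \<Longrightarrow> card (vex_peak_at_least n d c k) = card (vex (n - 2 * k) (d - k) c)"
proof (induction k arbitrary: n d)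
  case (Suc k)
  then show ?case
    by (simp add: card_vex_peak_at_least_Suc)
qed (simp add: vex_peak_at_least_0)

section \<open>First peaks of least value and the steps at the seams\<close>

definition vex_peak :: "nat \<Rightarrow> nat \<Rightarrow> nat \<Rightarrow> nat \<Rightarrow> (nat \<Rightarrow> nat) set" where
  "vex_peak n d c y = {p \<in> vex n d c. Suc (p d) = y}"

lemma finite_vex_peak: "finite (vex_peak n d c y)"
  unfolding vex_peak_def using finite_vex by simp

text \<open>Split by excess: at least 1, where one cycle can be deleted with both outer runs
  shortened, or exactly 0.\<close>

lemma card_vex_peak:
  assumes "1 \<le> c"
  shows "card (vex n d c) = card (vex (n - 2) (d - 1) c) + card (vex_peak n d c (d + 2 * c))"
proof -
  have "vex n d c = vex_peak_at_least n d c 1 \<union> vex_peak n d c (d + 2 * c)"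
    using vex_peak_ge[OF _ assms]
    by (fastforce simp: vex_peak_at_least_def vex_peak_def)
  moreover have "vex_peak_at_least n d c 1 \<inter> vex_peak n d c (d + 2 * c) = {}"
    by (auto simp: vex_peak_at_least_def vex_peak_def)
  ultimately show ?thesis
    using card_Un_disjoint[OF finite_vex_peak_at_least finite_vex_peak]
      card_vex_peak_at_least[OF assms, of n d 1] by simp
qed

text \<open>What remains of an element of \<open>vex_peak n d c (d + 2 * c)\<close> when the cycle of the first peak
  is deleted. The steps at the two seams are free, except that they cannot both be descents; the
  inequalities say that inserting the cycle recreates the peak and the valley.\<close>

definition vex_remainder :: "nat \<Rightarrow> nat \<Rightarrow> nat \<Rightarrow> (nat \<Rightarrow> nat) set" where
  "vex_remainder n d c = {q \<in> vex n (d + 1) (c - 1) \<union> vex n (d - 1) (c - 1) \<union> vex n (d + 1) (c - 2).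
     q (d - 1) + 4 \<le> d + 2 * c \<and> q d + 3 \<le> d + 2 * c}"

lemma delete_cycle_vex_remainder:
  assumes p: "p \<in> vex_peak n d c (d + 2 * c)" and c: "2 \<le> c"
  shows "delete_cycle d (d + 2 * c - 1) p \<in> vex_remainder (n - 2) d c"
    and "insert_cycle d (d + 2 * c - 1) (delete_cycle d (d + 2 * c - 1) p) = p"
proof -
  define b where "b = d + 2 * c - 1"
  have c1: "1 \<le> c" using c by simp
  have vex: "p \<in> vex n d c" and b: "p d = b"
    using p by (auto simp: vex_peak_def b_def)
  have d: "1 \<le> d"
    using vex_first_pos[OF vex c1] .
  have db: "d + 2 < b" "d < b" "Suc b = d + 2 * c"
    using c by (auto simp: b_def)
  obtain m where n: "n = m + 2"
    using vex_size(2)[OF vex c1] db b by (metis add.commute add_leD2 le_Suc_ex less_imp_le order_trans)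
  have inv: "involution_upto (m + 2) p"
    using vex_involution(1)[OF vex c1] n by simp
  note pp = vex_involution(2)[OF vex c1]
  define q where "q = delete_cycle d b p"
  show "insert_cycle d (d + 2 * c - 1) (delete_cycle d (d + 2 * c - 1) p) = p"
    using insert_delete_cycle[OF inv b db(2)] unfolding b_def .
  have pSd: "p (Suc d) < b"
    using vex_first_descent[OF vex c1] b by simp
  \<comment> \<open>The last descent gives \<open>p (b - 1) > p b = d\<close>, which rules out
    \<open>p (d - 1) = b - 1\<close>.\<close>
  have "p (Suc (b - 1)) < p (b - 1)"
    unfolding vex_descent_iff[OF vex c1] using db by presburger
  then have "d < p (b - 1)"
    using db pp[of d] b by simp
  moreover have "p (b - 1) = d - 1" if "p (d - 1) = b - 1"
    using pp[of "d - 1"] that by simp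
  moreover have "p (d - 1) < b"
    using vex_prefix[OF vex c1, of "d - 1" d] d b by simp
  ultimately have pd1: "p (d - 1) < b - 1"
    by (cases "p (d - 1) = b - 1") auto
  have q_small: "q (d - 1) + 3 \<le> b" "q d + 2 \<le> b"
    using pd1 pSd db d by (auto simp: q_def delete_cycle_def spread_def squash_def)
  \<comment> \<open>Only \<open>i = d - 1\<close> and \<open>i = b - 2\<close> join positions that
    were not adjacent; between the seams the descents of \<open>p\<close> shift by one.\<close>
  have desc: "i \<in> descents q \<longleftrightarrow>
      (if Suc i = d then p (Suc d) < p (d - 1)
       else if i + 2 = b then p (Suc b) < p (b - 1)
       else d \<le> i \<and> i + 2 < b \<and> odd (i + d))" for i
  proof -
    have q: "i \<in> descents q \<longleftrightarrow> p (spread d b (Suc i)) < p (spread d b i)"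
      unfolding q_def by (rule descents_delete_cycle[OF inv b db(2)])
    consider "Suc i < d" | "Suc i = d" | "d \<le> i" "i + 2 < b" | "i + 2 = b" "d \<le> i" | "b \<le> Suc i"
      using db by linarith
    then show ?thesis
    proof cases
      case 1
      then show ?thesis
        using q vex_descent_iff[OF vex c1, of i] db by (auto simp: spread_def)
    next
      case 2
      then have "i = d - 1" by simp
      then show ?thesis
        using q d db by (auto simp: spread_def)
    next
      case 3
      then have "i \<in> descents q \<longleftrightarrow> p (Suc (Suc i)) < p (Suc i)"
        using q by (simp add: spread_def)
      also have "\<dots> \<longleftrightarrow> d \<le> i \<and> i + 2 < b \<and> odd (i + d)"
        unfolding vex_descent_iff[OF vex c1] using 3 db by presburger
      finally show ?thesis
        using 3 by simp
    next
      case 4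
      then have "i \<in> descents q \<longleftrightarrow> p (Suc b) < p (b - 1)"
        using q by (auto simp: spread_def)
      with 4 show ?thesis by simp
    next
      case 5
      then have "i \<notin> descents q"
        using q vex_suffix[OF vex c1, of "i + 2" "Suc i + 2"] b db by (auto simp: spread_def)
      with 5 db show ?thesis by auto
    qed
  qed
  have q: "involution_upto m q" "avoids_2143 q"
    using involution_delete_cycle[OF inv b db(2)] avoids_delete_cycle[OF inv b db(2)] vex
    by (simp_all add: vex_def q_def)
  \<comment> \<open>This removes truncated subtraction, so that \<open>presburger\<close> can
    compare the descent sets.\<close>
  obtain e d' where e: "c = e + 2" "d = d' + 1"
    using c d by (metis add.commute le_Suc_ex)
  have b_eq: "b = d' + 2 * e + 4"
    using db e by simp
  have diffs: "e + 2 - 1 = e + 1" "e + 2 - 2 = e" "d' + 1 - 1 = d'"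
    by simp_all
  have "q \<in> vex m (d + 1) (c - 1) \<union> vex m (d - 1) (c - 1) \<union> vex m (d + 1) (c - 2)"
  proof (cases "p (Suc d) < p (d - 1)"; cases "p (Suc b) < p (b - 1)")
    assume A: "p (Suc d) < p (d - 1)" "p (Suc b) < p (b - 1)"
    have "i \<in> descents q \<longleftrightarrow> i \<in> every_other (d - 1) c" for i
      by (simp only: desc A[unfolded e b_eq diffs] every_other_def mem_Collect_eq e b_eq diffs
          if_True if_False) presburger
    then have "q \<in> vex m (d - 1) c"
      using q by (auto simp: vex_def)
    \<comment> \<open>With descents at both seams, \<open>vex_peak_ge\<close> gives
      \<open>q (d - 1) \<ge> d + 2 * c - 2\<close>, contrary to \<open>q_small\<close>.\<close>
    then have False
      using vex_peak_ge[of q m "d - 1" c] c1 q_small db d by simp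
    then show ?thesis ..
  next
    assume A: "\<not> p (Suc d) < p (d - 1)" "p (Suc b) < p (b - 1)"
    have "i \<in> descents q \<longleftrightarrow> i \<in> every_other (d + 1) (c - 1)" for i
      by (simp only: desc A[unfolded e b_eq diffs] every_other_def mem_Collect_eq e b_eq diffs
          if_True if_False) presburger
    then show ?thesis
      using q by (auto simp: vex_def)
  next
    assume A: "p (Suc d) < p (d - 1)" "\<not> p (Suc b) < p (b - 1)"
    have "i \<in> descents q \<longleftrightarrow> i \<in> every_other (d - 1) (c - 1)" for i
      by (simp only: desc A[unfolded e b_eq diffs] every_other_def mem_Collect_eq e b_eq diffs
          if_True if_False) presburger
    then show ?thesis
      using q by (auto simp: vex_def)
  next
    assume A: "\<not> p (Suc d) < p (d - 1)" "\<not> p (Suc b) < p (b - 1)"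
    have "i \<in> descents q \<longleftrightarrow> i \<in> every_other (d + 1) (c - 2)" for i
      by (simp only: desc A[unfolded e b_eq diffs] every_other_def mem_Collect_eq e b_eq diffs
          if_True if_False) presburger
    then show ?thesis
      using q by (auto simp: vex_def)
  qed
  then show "delete_cycle d (d + 2 * c - 1) p \<in> vex_remainder (n - 2) d c"
    using q_small db n unfolding vex_remainder_def q_def b_def by auto
qed

lemma insert_cycle_vex_remainder:
  assumes q: "q \<in> vex_remainder (n - 2) d c" and c: "2 \<le> c" and d: "1 \<le> d" and n: "d + 2 * c \<le> n + 1"
  shows "insert_cycle d (d + 2 * c - 1) q \<in> vex_peak n d c (d + 2 * c)"
proof -
  define b where "b = d + 2 * c - 1"
  define p where "p = insert_cycle d b q"
  have db: "d + 2 < b" "d < b" "Suc b = d + 2 * c"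
    using c by (auto simp: b_def)
  have bn: "b \<le> n - 2 + 2" "2 \<le> n"
    using n db by auto
  have q_small: "q (d - 1) + 3 \<le> b" "q d + 2 \<le> b"
    using q db unfolding vex_remainder_def by auto
  have invq: "involution_upto (n - 2) q" and avq: "avoids_2143 q"
    using q unfolding vex_remainder_def vex_def by auto
  have qq: "q (q x) = x" for x
    using invq by (simp add: involution_upto_def)
  \<comment> \<open>The three candidates differ only at the seams \<open>d - 1\<close> and
    \<open>b - 2\<close>; hence the uniform facts on prefix, middle and suffix below.\<close>
  have desc: "descents q \<in> {every_other (d + 1) (c - 1), every_other (d - 1) (c - 1), every_other (d + 1) (c - 2)}"
    using q unfolding vex_remainder_def vex_def by auto
  have desc_prefix: "i \<notin> descents q" if "Suc i < d" for i
  proof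
    assume "i \<in> descents q"
    with desc have "i \<in> every_other (d + 1) (c - 1) \<union> every_other (d - 1) (c - 1) \<union> every_other (d + 1) (c - 2)"
      by blast
    with that show False
      by (auto dest: every_other_ge)
  qed
  obtain e d' where e: "c = e + 2" "d = d' + 1"
    using c d by (metis add.commute le_Suc_ex)
  have b_eq: "b = d' + 2 * e + 4"
    using db e by simp
  have diffs: "e + 2 - 1 = e + 1" "e + 2 - 2 = e" "d' + 1 - 1 = d'"
    by simp_all
  have desc_suffix: "i \<notin> descents q" if "b \<le> Suc i" for i
  proof -
    note i = that[unfolded b_eq]
    have "i \<notin> every_other (d + 1) (c - 1)"
      unfolding every_other_def mem_Collect_eq e diffs using i by presburger
    moreover have "i \<notin> every_other (d - 1) (c - 1)"
      unfolding every_other_def mem_Collect_eq e diffs using i by presburger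
    moreover have "i \<notin> every_other (d + 1) (c - 2)"
      unfolding every_other_def mem_Collect_eq e diffs using i by presburger
    ultimately show ?thesis
      using desc by blast
  qed
  have desc_middle: "i \<in> descents q \<longleftrightarrow> odd (i + d)" if "d \<le> i" "i + 2 < b" for i
  proof -
    note i = that[unfolded b_eq e]
    have "i \<in> every_other (d + 1) (c - 1) \<longleftrightarrow> odd (i + d)"
      unfolding every_other_def mem_Collect_eq e diffs using i by presburger
    moreover have "i \<in> every_other (d - 1) (c - 1) \<longleftrightarrow> odd (i + d)"
      unfolding every_other_def mem_Collect_eq e diffs using i by presburger
    moreover have "i \<in> every_other (d + 1) (c - 2) \<longleftrightarrow> odd (i + d)"
      unfolding every_other_def mem_Collect_eq e diffs using i by presburger
    ultimately show ?thesis
      using desc by auto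
  qed
  have prefix: "q x < q y" if "x < y" "y < d" for x y
    using increasing_between_descents[OF invq, of 0 "d - 1" x y] desc_prefix that by auto
  have suffix: "q x < q y" if "b - 1 \<le> x" "x < y" for x y
    using increasing_between_descents[OF invq, of "b - 1" y x y] desc_suffix that by auto
  have prefix_small: "q x + 3 \<le> b" if "x < d" for x
  proof -
    have "x = d - 1 \<or> x < d - 1"
      using that by linarith
    then show ?thesis
      using prefix[of x "d - 1"] q_small(1) that by auto
  qed
  have inv: "involution_upto (n - 2 + 2) p"
    unfolding p_def by (rule involution_insert_cycle[OF invq d db(2) bn(1)])
  have pd: "p d = b" and pb: "p b = d"
    unfolding p_def using insert_cycle_endpoints db by auto
  have del: "delete_cycle d b p = q"
    unfolding p_def by (rule delete_insert_cycle[OF db(2)])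
  note eqs = insert_cycle_eqs[OF db(2), of _ q, folded p_def]
  have below: "p x < p y" if "x < y" "y \<le> d" for x y
  proof (cases "y = d")
    case True
    then show ?thesis
      using prefix_small[of x] that eqs(1)[of x] pd by (auto simp: spread_def)
  next
    case False
    with that show ?thesis
      using prefix[of x y] eqs(1) spread_less_iff[OF db(2)] by simp
  qed
  have above: "p x < p y" if "b < x" "x < y" for x y
  proof -
    have "b - 1 \<le> x - 2" "x - 2 < y - 2"
      using that db by linarith+
    then show ?thesis
      using suffix[of "x - 2" "y - 2"] that eqs(3) spread_less_iff[OF db(2)] by simp
  qed
  have avoid: "avoids_2143 p"
    using avoids_insert_cycle[OF inv pd db(2)] below above del avq by auto
  \<comment> \<open>Positions below \<open>d\<close> have values at most \<open>b - 3\<close>, so by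
    involutivity positions from \<open>b - 2\<close> on have values at least \<open>d\<close>. This
    makes \<open>b\<close> a valley after insertion.\<close>
  have q_large: "d \<le> q x" if "b \<le> x + 2" for x
    using prefix_small[of "q x"] qq[of x] that by (cases "d \<le> q x") auto
  have "p (Suc i) < p i \<longleftrightarrow> i \<in> every_other d c" for i
  proof -
    consider "i < d" | "i = d" | "d < i" "Suc i < b" | "Suc i = b" "d < i" | "i = b" | "b < i"
      using db by linarith
    then show ?thesis
    proof cases
      case 1
      then show ?thesis
        using below[of i "Suc i"] by (auto simp: every_other_def)
    next
      case 2
      then show ?thesis
        using eqs(2)[of "Suc d"] q_small(2) db pd by (auto simp: every_other_def spread_def)
    next
      case 3
      have i: "Suc (i - 1) = i" using 3 by simp
      have "p (Suc i) < p i \<longleftrightarrow> q (Suc (i - 1)) < q (i - 1)"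
        using 3 eqs(2)[of i] eqs(2)[of "Suc i"] spread_less_iff[OF db(2)] by (simp add: i)
      also have "\<dots> \<longleftrightarrow> i - 1 \<in> descents q"
        by (simp add: descents_def)
      also have "\<dots> \<longleftrightarrow> odd (i - 1 + d)"
        using 3 by (intro desc_middle) auto
      also have "\<dots> \<longleftrightarrow> i \<in> every_other d c"
        unfolding every_other_def mem_Collect_eq using 3 db by presburger
      finally show ?thesis .
    next
      case 4
      then have "d < p i"
        using eqs(2)[of i] q_large[of "i - 1"] by (auto simp: spread_def)
      moreover have "i \<in> every_other d c"
        unfolding every_other_def mem_Collect_eq using 4 db by presburger
      ultimately show ?thesis
        using 4 pb by simp
    next
      case 5
      have "d \<le> q (b - 1)"
        using db by (intro q_large) simp
      then have "d < p (Suc i)"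
        using 5 eqs(3)[of "Suc i"] by (auto simp: spread_def)
      moreover have "i \<notin> every_other d c"
        unfolding every_other_def mem_Collect_eq using 5 db by presburger
      ultimately show ?thesis
        using 5 pb by simp
    next
      case 6
      with above[of i "Suc i"] db show ?thesis
        by (simp add: every_other_def)
    qed
  qed
  then have "descents p = every_other d c"
    by (auto simp: descents_def)
  moreover have "n - 2 + 2 = n"
    using bn by simp
  ultimately have "p \<in> vex n d c"
    using avoid inv by (simp add: vex_def)
  with pd db show ?thesis
    by (simp add: vex_peak_def p_def b_def)
qed

lemma card_vex_remainder:
  assumes "2 \<le> c" "1 \<le> d" "d + 2 * c \<le> n + 1"
  shows "card (vex_peak n d c (d + 2 * c)) = card (vex_remainder (n - 2) d c)"
proof (rule bij_betw_same_card, rule bij_betw_byWitness[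
      where f = "delete_cycle d (d + 2 * c - 1)" and f' = "insert_cycle d (d + 2 * c - 1)"])
  show "\<forall>q\<in>vex_remainder (n - 2) d c.
      delete_cycle d (d + 2 * c - 1) (insert_cycle d (d + 2 * c - 1) q) = q"
    using assms(1) by (auto intro!: delete_insert_cycle)
qed (use delete_cycle_vex_remainder insert_cycle_vex_remainder assms in auto)

lemma vex_disjoint: "every_other d c \<noteq> every_other d' c' \<Longrightarrow> vex n d c \<inter> vex n d' c' = {}"
  by (auto simp: vex_def)

text \<open>By \<open>vex_band\<close>, the inequalities of \<open>vex_remainder\<close> allow
  excess 0 in the first two families and at most 2 in the third. The members excluded, with excess
  at least 1 or 3, are counted by \<open>card_vex_peak_at_least\<close>; they are added on the left
  to avoid subtraction. For \<open>c = 2\<close> the third family is \<open>{id}\<close>, and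
  nothing is excluded.\<close>

lemma card_vex_remainder_eq:
  assumes c: "2 \<le> c" and d: "1 \<le> d"
  shows "card (vex_remainder n d c) + card (vex (n - 2) d (c - 1)) + card (vex (n - 2) (d - 2) (c - 1))
      + (if c = 2 then 0 else card (vex (n - 6) (d - 2) (c - 2)))
    = card (vex n (d + 1) (c - 1)) + card (vex n (d - 1) (c - 1)) + card (vex n (d + 1) (c - 2))"
proof -
  define E where "E = {q :: nat \<Rightarrow> nat. q (d - 1) + 4 \<le> d + 2 * c \<and> q d + 3 \<le> d + 2 * c}"
  have c1: "1 \<le> c - 1" using c by simp
  have E1: "vex n (d + 1) (c - 1) \<inter> E = vex n (d + 1) (c - 1) - vex_peak_at_least n (d + 1) (c - 1) 1"
  proof -
    have "q \<in> E \<longleftrightarrow> \<not> d + 1 + 2 * (c - 1) + 1 \<le> Suc (q (d + 1))" if q: "q \<in> vex n (d + 1) (c - 1)" for q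
      using vex_peak_ge[OF q c1] vex_prefix[OF q c1, of d "d + 1"] vex_prefix[OF q c1, of "d - 1" d]
        vex_band(1)[OF q c1] c d by (auto simp: E_def)
    then show ?thesis
      by (auto simp: vex_peak_at_least_def)
  qed
  have E2: "vex n (d - 1) (c - 1) \<inter> E = vex n (d - 1) (c - 1) - vex_peak_at_least n (d - 1) (c - 1) 1"
  proof -
    have "q \<in> E \<longleftrightarrow> \<not> d - 1 + 2 * (c - 1) + 1 \<le> Suc (q (d - 1))" if q: "q \<in> vex n (d - 1) (c - 1)" for q
      using vex_peak_ge[OF q c1] vex_first_descent[OF q c1] vex_first_pos[OF q c1] c d
      by (auto simp: E_def)
    then show ?thesis
      by (auto simp: vex_peak_at_least_def)
  qed
  have E3: "card (vex n (d + 1) (c - 2) \<inter> E) + (if c = 2 then 0 else card (vex (n - 6) (d - 2) (c - 2)))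
    = card (vex n (d + 1) (c - 2))"
  proof (cases "c = 2")
    case True
    then have "vex n (d + 1) (c - 2) \<inter> E = vex n (d + 1) (c - 2)"
      using d by (auto simp: vex_0 E_def)
    with True show ?thesis by simp
  next
    case False
    then have c2: "1 \<le> c - 2" using c by simp
    have "q \<in> E \<longleftrightarrow> \<not> d + 1 + 2 * (c - 2) + 3 \<le> Suc (q (d + 1))" if q: "q \<in> vex n (d + 1) (c - 2)" for q
      using vex_peak_ge[OF q c2] vex_prefix[OF q c2, of d "d + 1"] vex_prefix[OF q c2, of "d - 1" d]
        vex_band(1)[OF q c2] c2 d by (auto simp: E_def)
    then have "vex n (d + 1) (c - 2) = (vex n (d + 1) (c - 2) \<inter> E) \<union> vex_peak_at_least n (d + 1) (c - 2) 3"
      and "vex n (d + 1) (c - 2) \<inter> E \<inter> vex_peak_at_least n (d + 1) (c - 2) 3 = {}"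
      by (auto simp: vex_peak_at_least_def)
    then have "card (vex n (d + 1) (c - 2))
        = card (vex n (d + 1) (c - 2) \<inter> E) + card (vex_peak_at_least n (d + 1) (c - 2) 3)"
      using card_Un_disjoint finite_vex finite_vex_peak_at_least finite_Int by metis
    with False show ?thesis
      using card_vex_peak_at_least[OF c2, of n "d + 1" 3] by simp
  qed
  have diff: "card (vex n d' (c - 1) - vex_peak_at_least n d' (c - 1) 1) + card (vex (n - 2) (d' - 1) (c - 1))
      = card (vex n d' (c - 1))" for d'
  proof -
    have "vex_peak_at_least n d' (c - 1) 1 \<subseteq> vex n d' (c - 1)"
      by (auto simp: vex_peak_at_least_def)
    then show ?thesis
      using card_vex_peak_at_least[OF c1, of n d' 1]
        card_mono[OF finite_vex, of "vex_peak_at_least n d' (c - 1) 1" n d' "c - 1"]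
      by (simp add: card_Diff_subset finite_vex_peak_at_least)
  qed
  have ne: "every_other (d + 1) (c - 1) \<noteq> every_other (d - 1) (c - 1)"
      "every_other (d + 1) (c - 1) \<noteq> every_other (d + 1) (c - 2)"
      "every_other (d - 1) (c - 1) \<noteq> every_other (d + 1) (c - 2)"
  proof -
    have "d - 1 \<in> every_other (d - 1) (c - 1)" "d - 1 \<notin> every_other (d + 1) c'" for c'
      using c d by (auto simp: every_other_def)
    then show "every_other (d + 1) (c - 1) \<noteq> every_other (d - 1) (c - 1)"
      "every_other (d - 1) (c - 1) \<noteq> every_other (d + 1) (c - 2)"
      by auto
    have "d + 1 + 2 * (c - 1) - 2 \<in> every_other (d + 1) (c - 1)"
      "d + 1 + 2 * (c - 1) - 2 \<notin> every_other (d + 1) (c - 2)"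
      using c by (auto simp: every_other_def)
    then show "every_other (d + 1) (c - 1) \<noteq> every_other (d + 1) (c - 2)"
      by blast
  qed
  have "vex_remainder n d c = vex n (d + 1) (c - 1) \<inter> E \<union> vex n (d - 1) (c - 1) \<inter> E \<union> vex n (d + 1) (c - 2) \<inter> E"
    by (auto simp: vex_remainder_def E_def)
  also have "card \<dots> = card (vex n (d + 1) (c - 1) \<inter> E) + card (vex n (d - 1) (c - 1) \<inter> E)
      + card (vex n (d + 1) (c - 2) \<inter> E)"
    using ne[THEN vex_disjoint, of n] finite_vex
    by (subst card_Un_disjoint, simp, simp, blast, subst card_Un_disjoint, simp, simp, blast, simp)
  finally have card_remainder: "card (vex_remainder n d c) = \<dots>" .
  have d_diffs: "d + 1 - 1 = d" "d - 1 - 1 = d - 2"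
    by simp_all
  show ?thesis
    using card_remainder E3 diff[of "d + 1", unfolded d_diffs] diff[of "d - 1", unfolded d_diffs]
    unfolding E1 E2 by linarith
qed

text \<open>With one descent the two seams coincide, so this case is separate. Deleting the cycle
  leaves no descent, hence the identity.\<close>

lemma vex_peak_one_descent:
  assumes d: "1 \<le> d" and n: "d + 1 \<le> n"
  shows "vex_peak n d 1 (d + 2) = {insert_cycle d (d + 1) id}"
proof (intro equalityI subsetI)
  fix p assume "p \<in> vex_peak n d 1 (d + 2)"
  then have vex: "p \<in> vex n d 1" and pd: "p d = d + 1"
    by (auto simp: vex_peak_def)
  obtain m where m: "n = m + 2"
    using d n by (metis add.commute add_leD2 le_Suc_ex nat_1_add_1 add_le_mono1 order_trans)
  have inv: "involution_upto (m + 2) p"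
    using vex_involution(1)[OF vex] m by simp
  have pSd: "p (Suc d) = d"
    using vex_involution(2)[OF vex _, of d] pd by simp
  have "p (d - 1) < p d"
    using vex_prefix[OF vex, of "d - 1" d] d by simp
  then have pd1: "p (d - 1) < d"
    using pd pSd involution_upto_inj[OF inv, of "d - 1" "Suc d"] by linarith
  have suffix: "p x < p y" if "Suc d \<le> x" "x < y" for x y
    using vex_suffix[OF vex, of x y] that pd by simp
  have "i \<notin> descents (delete_cycle d (d + 1) p)" for i
  proof -
    have iff: "i \<in> descents (delete_cycle d (d + 1) p)
        \<longleftrightarrow> p (spread d (d + 1) (Suc i)) < p (spread d (d + 1) i)"
      by (rule descents_delete_cycle[OF inv pd]) simp
    consider "Suc i < d" | "Suc i = d" | "d \<le> i" by linarith
    then show ?thesis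
    proof cases
      case 1
      then show ?thesis
        using iff vex_prefix[OF vex, of i "Suc i"] by (simp add: spread_def)
    next
      case 2
      then have "i = d - 1" by simp
      then show ?thesis
        using iff suffix[of "Suc d" "d + 2"] pSd pd1 d by (auto simp: spread_def)
    next
      case 3
      then show ?thesis
        using iff suffix[of "i + 2" "Suc i + 2"] by (simp add: spread_def)
    qed
  qed
  then have "delete_cycle d (d + 1) p = id"
    using no_descents_imp_id[OF involution_delete_cycle[OF inv pd]] by auto
  then show "p \<in> {insert_cycle d (d + 1) id}"
    using insert_delete_cycle[OF inv pd] by simp
next
  fix p assume "p \<in> {insert_cycle d (d + 1) id}"
  then have p: "p = insert_cycle d (d + 1) id" by simp
  have p_eq: "p x = (if x = d then d + 1 else if x = d + 1 then d else x)" for x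
    by (auto simp: p insert_cycle_def spread_def squash_def)
  have inv: "involution_upto (n - 2 + 2) p"
    unfolding p using d n by (intro involution_insert_cycle) (auto simp: involution_upto_def)
  have "delete_cycle d (d + 1) p = id"
    by (simp add: p delete_insert_cycle)
  then have "avoids_2143 (delete_cycle d (d + 1) p)"
    by (simp add: avoids_2143_def)
  then have "avoids_2143 p"
    by (rule avoids_insert_cycle[OF inv, rotated 2]) (auto simp: p_eq)
  moreover have "descents p = every_other d 1"
    by (auto simp: descents_def every_other_def p_eq)
  moreover have "n - 2 + 2 = n"
    using d n by simp
  ultimately show "p \<in> vex_peak n d 1 (d + 2)"
    using inv by (auto simp: vex_peak_def vex_def p_eq)
qed

section \<open>The recursion in the lengths of the outer runs\<close>

text \<open>Integer arguments let the recursion reach below 0; by \<open>vex_count_neg\<close> such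
  terms vanish for \<open>c \<ge> 1\<close>.\<close>

definition vex_count :: "nat \<Rightarrow> int \<Rightarrow> int \<Rightarrow> int" where
  "vex_count c s t = int (card (vex (nat (s + t + 2 * int c)) (nat (s + 1)) c))"

lemma vex_count_neg:
  assumes "1 \<le> c" "s < 0 \<or> t < 0"
  shows "vex_count c s t = 0"
proof -
  have "vex (nat (s + t + 2 * int c)) (nat (s + 1)) c = {}"
  proof (cases "s < 0")
    case True
    then show ?thesis
      using vex_first_pos_0[OF assms(1)] by simp
  next
    case False
    then have "\<not> nat (s + 1) + 2 * c \<le> nat (s + t + 2 * int c) + 1"
      using assms by linarith
    then show ?thesis
      using vex_size(1)[OF _ assms(1)] by blast
  qed
  then show ?thesis
    by (simp add: vex_count_def)
qed

lemma vex_count_one: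
  assumes "0 \<le> s" "0 \<le> t"
  shows "vex_count 1 s t = vex_count 1 (s - 1) (t - 1) + 1"
proof -
  obtain a b where [simp]: "s = int a" "t = int b"
    using assms by (metis nonneg_int_cases)
  have N: "nat (int a + int b + 2) = a + b + 2" "nat (int a + 1) = a + 1"
      "nat (int a + int b) = a + b" "nat (int a) = a"
    by linarith+
  show ?thesis
    using card_vex_peak[of 1 "a + b + 2" "a + 1"] vex_peak_one_descent[of "a + 1" "a + b + 2"]
    by (simp add: vex_count_def N)
qed

text \<open>The positive terms after the first are the three families of remainders, each followed
  by its correction for too high a peak. For \<open>c = 0\<close> the last family is
  \<open>{id}\<close>.\<close>

lemma vex_count_rec:
  assumes "0 \<le> s" "0 \<le> t"
  shows "vex_count (c + 2) s t = vex_count (c + 2) (s - 1) (t - 1)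
    + vex_count (c + 1) (s + 1) (t - 1) - vex_count (c + 1) s (t - 2)
    + vex_count (c + 1) (s - 1) (t + 1) - vex_count (c + 1) (s - 2) t
    + (if c = 0 then 1 else vex_count c (s + 1) (t + 1) - vex_count c (s - 2) (t - 2))"
proof -
  obtain a b where st: "s = int a" "t = int b"
    using assms by (metis nonneg_int_cases)
  define n where "n = a + b + 2 * c + 2"
  have count: "vex_count k s' t' = int (card (vex N D k))"
    if "nat (s' + t' + 2 * int k) = N" "nat (s' + 1) = D" for k s' t' N D
    using that by (simp add: vex_count_def)
  have counts:
    "vex_count (c + 2) s t = int (card (vex (n + 2) (a + 1) (c + 2)))"
    "vex_count (c + 2) (s - 1) (t - 1) = int (card (vex n a (c + 2)))"
    "vex_count (c + 1) (s + 1) (t - 1) = int (card (vex n (a + 2) (c + 1)))"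
    "vex_count (c + 1) s (t - 2) = int (card (vex (n - 2) (a + 1) (c + 1)))"
    "vex_count (c + 1) (s - 1) (t + 1) = int (card (vex n a (c + 1)))"
    "vex_count (c + 1) (s - 2) t = int (card (vex (n - 2) (a - 1) (c + 1)))"
    "vex_count c (s + 1) (t + 1) = int (card (vex n (a + 2) c))"
    "vex_count c (s - 2) (t - 2) = int (card (vex (n - 6) (a - 1) c))"
    by (rule count; simp add: n_def st; linarith)+
  have "card (vex (n + 2) (a + 1) (c + 2)) = card (vex n a (c + 2)) + card (vex_remainder n (a + 1) (c + 2))"
    using card_vex_peak[of "c + 2" "n + 2" "a + 1"] card_vex_remainder[of "c + 2" "a + 1" "n + 2"]
    by (simp add: n_def)
  moreover have "card (vex n (a + 2) 0) = 1"
    by (simp add: vex_0)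
  ultimately show ?thesis
    using card_vex_remainder_eq[of "c + 2" "a + 1" n] unfolding counts
    by (cases "c = 0") simp_all
qed

section \<open>Paths between bounded heights\<close>

text \<open>The number of Motzkin-type paths of length \<open>j\<close> from height at most \<open>s\<close> to height at most \<open>t\<close>,
  by the first step; the last term removes the paths that start at height \<open>-1\<close> with an up step.\<close>

fun path_count :: "nat \<Rightarrow> int \<Rightarrow> int \<Rightarrow> int" where
  "path_count 0 s t = max 0 (min s t + 1)"
| "path_count (Suc j) s t = (if s < 0 then 0
     else path_count j (s - 1) t + path_count j s t + path_count j (s + 1) t - path_count j 0 t)"

lemma path_count_neg: "s < 0 \<or> t < 0 \<Longrightarrow> path_count j s t = 0"
  by (induction j arbitrary: s t) auto

text \<open>At \<open>s = - 1\<close> the first two terms vanish and the other two cancel.\<close>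

lemma path_count_first_step:
  "- 1 \<le> s \<Longrightarrow> path_count (Suc j) s t
    = path_count j (s - 1) t + path_count j s t + path_count j (s + 1) t - path_count j 0 t"
  by (cases "s = - 1") (auto simp: path_count_neg)

text \<open>Induction on the length: splitting off the first step commutes with splitting off the
  last.\<close>

lemma path_count_last_step:
  "- 1 \<le> t \<Longrightarrow> path_count (Suc j) s t
    = path_count j s (t - 1) + path_count j s t + path_count j s (t + 1) - path_count j s 0"
proof (induction j arbitrary: s t)
  case 0
  then show ?case
    by (auto simp: max_def min_def)
next
  case (Suc j)
  show ?case
  proof (cases "s < 0")
    case True
    then show ?thesis
      by (simp add: path_count_neg)
  next
    case False
    then show ?thesis
      using Suc.IH[OF Suc.prems, of "s - 1"] Suc.IH[OF Suc.prems, of s]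
        Suc.IH[OF Suc.prems, of "s + 1"] Suc.IH[OF Suc.prems, of 0]
      unfolding path_count.simps(2)[of "Suc j"] by (simp add: path_count_first_step[of s] del: path_count.simps)
  qed
qed

lemma path_count_rec:
  assumes "0 \<le> s" "0 \<le> t"
  shows "path_count (Suc (Suc j)) s t = path_count (Suc (Suc j)) (s - 1) (t - 1)
    + path_count (Suc j) (s + 1) (t - 1) - path_count (Suc j) s (t - 2)
    + path_count (Suc j) (s - 1) (t + 1) - path_count (Suc j) (s - 2) t
    + path_count j (s + 1) (t + 1) - path_count j (s - 2) (t - 2)"
proof -
  have shift: "x - 1 - 1 = x - 2" "x - 2 + 1 = x - 1" "x + 1 - 1 = x" "x - 1 + 1 = x" for x :: int
    by auto
  note first = path_count_first_step and last = path_count_last_step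
  show ?thesis
    \<comment> \<open>Everything is reduced to length \<open>j\<close>, where the terms cancel. As
      \<open>s - 2\<close> and \<open>t - 2\<close> may be below -1, the term at
      \<open>s, t - 2\<close> is expanded by its first step and the one at \<open>s - 2, t\<close>
      by its last.\<close>
    using assms
      first[of s "Suc j" t] first[of "s - 1" "Suc j" "t - 1"]
      last[of t j "s - 1"] last[of t j s] last[of t j "s + 1"] last[of t j 0]
      last[of "t - 1" j "s - 2"] last[of "t - 1" j "s - 1"] last[of "t - 1" j s] last[of "t - 1" j 0]
      last[of "t - 1" j "s + 1"] first[of s j "t - 2"] first[of "s - 1" j "t + 1"] last[of t j "s - 2"]
    by (simp add: shift del: path_count.simps)
qed

text \<open>The constant 1 replaces the terms of length \<open>j - 2\<close>, as it does in
  \<open>vex_count_rec\<close> for \<open>c = 0\<close>.\<close>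

lemma path_count_one:
  assumes "0 \<le> s" "0 \<le> t"
  shows "path_count 1 s t = path_count 1 (s - 1) (t - 1)
    + path_count 0 (s + 1) (t - 1) - path_count 0 s (t - 2)
    + path_count 0 (s - 1) (t + 1) - path_count 0 (s - 2) t + 1"
  using assms by (auto simp: max_def min_def)

text \<open>Both sides obey the same recursion. One of its terms keeps \<open>j\<close> and lowers
  \<open>s\<close>, hence an inner induction on a bound \<open>k\<close> for \<open>s\<close> inside
  the strong induction on \<open>j\<close>.\<close>

lemma vex_count_eq_path_count: "vex_count (Suc j) s t = path_count j s t"
proof (induction j arbitrary: s t rule: less_induct)
  case (less j)
  have "vex_count (Suc j) s t = path_count j s t" if "s < int k" for k s t
    using that
  proof (induction k arbitrary: s t)
    case 0
    then show ?case
      by (simp add: vex_count_neg path_count_neg)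
  next
    case (Suc k)
    show ?case
    proof (cases "s < 0 \<or> t < 0")
      case True
      then show ?thesis
        by (auto simp: vex_count_neg path_count_neg)
    next
      case False
      then have st: "0 \<le> s" "0 \<le> t" by auto
      have IH: "vex_count (Suc j) (s - 1) (t - 1) = path_count j (s - 1) (t - 1)"
        using Suc by simp
      consider "j = 0" | "j = 1" | i where "j = Suc (Suc i)"
        by (metis One_nat_def not0_implies_Suc)
      then show ?thesis
      proof cases
        case 1
        then show ?thesis
          using vex_count_one[OF st] IH st by (auto simp: max_def min_def)
      next
        case 2
        then show ?thesis
          using vex_count_rec[OF st, of 0] path_count_one[OF st] IH less.IH[of 0]
          by (simp add: numeral_2_eq_2 del: path_count.simps)
      next
        case 3
        then show ?thesis
          using vex_count_rec[OF st, of "Suc i"] path_count_rec[OF st, of i] IH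
            less.IH[of i] less.IH[of "Suc i"]
          by (simp del: path_count.simps)
      qed
    qed
  qed
  from this[of s "nat (s + 1)" t] show ?case by simp
qed

section \<open>Motzkin paths\<close>

text \<open>A variable starting height makes it possible to split off the first step.\<close>

definition paths_from :: "nat \<Rightarrow> int \<Rightarrow> (int \<times> int) list set" where
  "paths_from j h = {w. set w \<subseteq> {(1, 1), (1, - 1), (1, 0)} \<and> length w = j \<and>
     (\<forall>i\<le>length w. 0 \<le> h + snd (sum_list (take i w))) \<and> h + snd (sum_list w) = 0}"

lemma finite_paths_from: "finite (paths_from j h)"
  by (rule finite_subset[OF _ finite_lists_length_eq[of "{(1, 1), (1, - 1), (1, 0)}" j]])
    (auto simp: paths_from_def)

lemma paths_from_neg: "h < 0 \<Longrightarrow> paths_from j h = {}"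
  by (auto simp: paths_from_def)

lemma paths_from_0: "paths_from 0 h = (if h = 0 then {[]} else {})"
  by (auto simp: paths_from_def)

lemma paths_from_Suc:
  assumes "0 \<le> h"
  shows "paths_from (Suc j) h = (#) (1, 1) ` paths_from j (h + 1)
    \<union> (#) (1, - 1) ` paths_from j (h - 1) \<union> (#) (1, 0) ` paths_from j h"
    (is "?L = ?R")
proof -
  have all_Suc: "(\<forall>i\<le>Suc l. P i) \<longleftrightarrow> P 0 \<and> (\<forall>i\<le>l. P (Suc i))" for l and P :: "nat \<Rightarrow> bool"
    by (metis Suc_le_mono le0 not0_implies_Suc)
  have "x # w \<in> ?L \<longleftrightarrow> x # w \<in> ?R" for x w
    using assms by (auto simp: paths_from_def all_Suc image_iff algebra_simps)
  moreover have "[] \<notin> ?L" "[] \<notin> ?R"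
    by (auto simp: paths_from_def)
  ultimately show ?thesis
    by (metis (no_types) list.exhaust set_eqI)
qed

text \<open>Ending at height at most 0 means ending at 0; the difference isolates the paths that
  start exactly at \<open>h\<close>.\<close>

lemma card_paths_from: "0 \<le> h \<Longrightarrow> int (card (paths_from j h)) = path_count j h 0 - path_count j (h - 1) 0"
proof (induction j arbitrary: h)
  case 0
  then show ?case
    by (simp add: paths_from_0)
next
  case (Suc j)
  have IH: "int (card (paths_from j h')) = path_count j h' 0 - path_count j (h' - 1) 0" for h'
    using Suc.IH[of h'] by (cases "h' < 0") (simp_all add: paths_from_neg path_count_neg)
  have "card (paths_from (Suc j) h)
      = card (paths_from j (h + 1)) + card (paths_from j (h - 1)) + card (paths_from j h)"
    unfolding paths_from_Suc[OF Suc.prems]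
    by (subst card_Un_disjoint, auto simp: finite_paths_from)+
      (simp add: card_image)
  then show ?case
    using path_count_first_step[of h j 0] path_count_first_step[of "h - 1" j 0] Suc.prems
      IH[of "h + 1"] IH[of h] IH[of "h - 1"]
    by simp
qed

lemma motzkin_eq_path_count: "int (motzkin j) = path_count j 0 0"
proof -
  have fst_sum: "fst (sum_list w) = int (length w)" if "set w \<subseteq> {(1, 1), (1, - 1), (1, 0)}"
    for w :: "(int \<times> int) list"
    using that by (induction w) auto
  have "motzkin_paths j = paths_from j 0"
    using fst_sum by (force simp: motzkin_paths_def paths_from_def prod_eq_iff)
  then show ?thesis
    using card_paths_from[of 0 j] by (simp add: motzkin_def path_count_neg)
qed

section \<open>Translation to the original definitions\<close>

text \<open>An unbounded occurrence lies in \<open>{1..n}\<close> anyway: 0 is a fixed point and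
  cannot be the 2, and if \<open>l > n\<close> were the 3, then the larger value \<open>p k\<close>
  would force \<open>k > n\<close>, so both would be fixed and in increasing order.\<close>

lemma avoids_2143_iff:
  assumes "involution_upto n p"
  shows "avoids n p 4 (one_line [2, 1, 4, 3]) \<longleftrightarrow> avoids_2143 p"
proof -
  have dom: "{1..4::nat} = {Suc 0, 2, 3, 4}" by auto
  define t where "t = one_line [2, 1, 4, 3]"
  have t: "t (Suc 0) = 2" "t 2 = 1" "t 3 = 4" "t 4 = 3"
    by (simp_all add: t_def one_line_def)
  have "avoids n p 4 t" if "avoids_2143 p"
    unfolding avoids_def
  proof (intro notI; elim exE conjE)
    fix f
    assume f: "strict_mono_on {1..4} f"
      "\<forall>a\<in>{1..4}. \<forall>b\<in>{1..4}. p (f a) < p (f b) \<longleftrightarrow> t a < t b"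
    then have "f (Suc 0) < f 2" "f 2 < f 3" "f 3 < f 4"
      by (auto simp: strict_mono_on_def)
    moreover have "p (f 2) < p (f (Suc 0))" "p (f (Suc 0)) < p (f 4)" "p (f 4) < p (f 3)"
      using f(2) unfolding dom by (simp_all add: t)
    ultimately show False
      using that unfolding avoids_2143_def by blast
  qed
  moreover have "avoids_2143 p" if avoids: "avoids n p 4 t"
    unfolding avoids_2143_def
  proof (intro allI impI notI; elim conjE)
    fix i j k l
    assume ord: "i < j" "j < k" "k < l" "p j < p i" "p i < p l" "p l < p k"
    define f where "f = (\<lambda>x::nat. if x = 1 then i else if x = 2 then j else if x = 3 then k else l)"
    have f: "f (Suc 0) = i" "f 2 = j" "f 3 = k" "f 4 = l"
      by (simp_all add: f_def)
    have "i \<noteq> 0"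
      using ord involution_upto_0[OF assms] by (cases "i = 0") auto
    moreover have "l \<le> n"
    proof (rule ccontr)
      assume "\<not> l \<le> n"
      then have "p l = l"
        using assms by (simp add: involution_upto_def)
      moreover have "k \<le> n"
      proof (rule ccontr)
        assume "\<not> k \<le> n"
        then have "p k = k"
          using assms by (simp add: involution_upto_def)
        with \<open>p l = l\<close> ord show False by simp
      qed
      then have "p k \<le> n"
        using involution_upto_le[OF assms] by simp
      ultimately show False
        using ord \<open>\<not> l \<le> n\<close> by simp
    qed
    ultimately have "f ` {1..4} \<subseteq> {1..n}"
      using ord unfolding dom by (auto simp: f)
    moreover have "strict_mono_on {1..4} f"
      using ord unfolding dom strict_mono_on_def by (auto simp: f)
    moreover have "\<forall>a\<in>{1..4}. \<forall>b\<in>{1..4}.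
        p (f a) < p (f b) \<longleftrightarrow> t a < t b"
      using ord unfolding dom by (simp add: f t)
    ultimately show False
      using avoids unfolding avoids_def by blast
  qed
  ultimately show ?thesis
    unfolding t_def by blast
qed

lemma involution_upto_iff: "involution_upto n p \<longleftrightarrow> p permutes {1..n} \<and> inv p = p"
proof
  assume p: "involution_upto n p"
  then have "p \<circ> p = id"
    by (auto simp: involution_upto_def)
  then have "bij p" "inv p = p"
    using o_bij inv_unique_comp by blast+
  with p show "p permutes {1..n} \<and> inv p = p"
    by (simp add: permutes_def involution_upto_def bij_iff)
next
  assume p: "p permutes {1..n} \<and> inv p = p"
  then have "p (p x) = x" for x
    using permutes_inverses(1)[of p "{1..n}" x] by simp
  with p show "involution_upto n p"
    by (auto simp: involution_upto_def permutes_def)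
qed

text \<open>For even length the odd positions below \<open>2 * n\<close> are
  \<open>1, 3, ..., 2 * n - 1\<close>, which are \<open>n\<close> descents starting at 1.\<close>

lemma reverse_alternating_iff:
  assumes p: "involution_upto (2 * n) p"
  shows "reverse_alternating (2 * n) p \<longleftrightarrow> descents p = every_other 1 n"
proof -
  have outside: "i \<notin> descents p" if "i \<notin> {1..<2 * n}" for i
  proof (cases "i = 0")
    case True
    then show ?thesis
      using involution_upto_0[OF p] by (simp add: descents_def)
  next
    case False
    with that have "p (Suc i) = Suc i" "p i \<le> i"
      using p involution_upto_le[OF p, of i] unfolding involution_upto_def by (auto simp: not_less)
    then show ?thesis
      by (simp add: descents_def)
  qed
  have "i \<in> every_other 1 n \<longleftrightarrow> i \<in> {1..<2 * n} \<and> odd i" for i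
    unfolding every_other_def by (simp, presburger)
  with outside have "descents p = every_other 1 n
      \<longleftrightarrow> (\<forall>i\<in>{1..<2 * n}. i \<in> descents p \<longleftrightarrow> odd i)"
    by blast
  then show ?thesis
    by (simp add: reverse_alternating_def descents_def)
qed

lemma RAI_avoiding_eq_vex: "RAI_avoiding (2 * n) 4 (one_line [2, 1, 4, 3]) = vex (2 * n) 1 n"
proof -
  have "RAI_avoiding (2 * n) 4 (one_line [2, 1, 4, 3]) = {p. involution_upto (2 * n) p \<and>
      reverse_alternating (2 * n) p \<and> avoids (2 * n) p 4 (one_line [2, 1, 4, 3])}"
    unfolding RAI_avoiding_def RAI_def involution_upto_iff by blast
  then show ?thesis
    unfolding vex_def using avoids_2143_iff reverse_alternating_iff by blast
qed

theorem theorem7p4: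
  fixes n :: nat
  assumes "n \<ge> 1"
  shows "card (RAI_avoiding (2 * n) 4 (one_line [2, 1, 4, 3])) = motzkin (n - 1)"
proof -
  \<comment> \<open>Both outer runs are empty, and \<open>n\<close> descents correspond to paths of
    length \<open>n - 1\<close>.\<close>
  have "int (card (vex (2 * n) 1 n)) = vex_count (Suc (n - 1)) 0 0"
    using assms by (simp add: vex_count_def nat_mult_distrib)
  also have "\<dots> = int (motzkin (n - 1))"
    by (simp only: vex_count_eq_path_count motzkin_eq_path_count)
  finally show ?thesis
    unfolding RAI_avoiding_eq_vex by simp
qed

end
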